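(* Let $\mathcal{A}$ be a unital algebra over a field $\mathbb{F}$ of characteristic zero, with identity $I$. Let $P\in\mathcal{A}$ be a non-trivial idempotent, $Q=I-P$, $E_1=P$, $E_2=Q$, $\mathcal{A}_{ij}=E_i\mathcal{A}E_j$, and assume that every element of $\mathcal{A}_{11}$ is a linear combination of invertible elements of $\mathcal{A}_{11}$ and every element of $\mathcal{A}_{22}$ is a linear combination of invertible elements of $\mathcal{A}_{22}$. Suppose $\mathcal{A}_{12}$ is faithful with respect to $\mathcal{A}$, $\mathcal{A}_{21}=\{0\}$, and $C(\mathcal{A},\mathcal{A})=\mathbb{F}I$. Then every $C\in\mathcal{A}$ is a Jordan higher all-derivable point.
   Context: $L(\mathcal{A})$ is the set of all linear mappings from $\mathcal{A}$ to $\mathcal{A}$; $\mathbb{N}$ is the set of non-negative integers; $I_{\mathcal{A}}$ is the identity mapping on $\mathcal{A}$; $C(\mathcal{A},\mathcal{A})=\{M\in\mathcal{A}: AM=MA\text{ for every }A\in\mathcal{A}\}$. A sequence $\{d_i\}_{i\in\mathbb{N}}$ in $L(\mathcal{A})$ with $d_0=I_{\mathcal{A}}$ is a Jordan higher derivation if $d_n(AB+BA)=\sum_{i+j=n}(d_i(A)d_j(B)+d_i(B)d_j(A))$ for all $n\in\mathbb{N}$ and all $A,B\in\mathcal{A}$; it is Jordan higher derivable at $C\in\mathcal{A}$ if this identity holds for all $n\in\mathbb{N}$ and all $A,B\in\mathcal{A}$ with $AB=C$. An element $C\in\mathcal{A}$ is a Jordan higher all-derivable point if every sequence in $L(\mathcal{A})$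 with $d_0=I_{\mathcal{A}}$ that is Jordan higher derivable at $C$ is a Jordan higher derivation. Non-trivial idempotent means an idempotent different from $0$ and $I$. Invertible in $\mathcal{A}_{ii}$ means invertible with respect to the unit $E_i$, with inverse in $\mathcal{A}_{ii}$. $\mathcal{A}_{12}$ is faithful with respect to $\mathcal{A}$ if for every $M\in\mathcal{A}$: $M\mathcal{A}_{12}=\{0\}$ implies $MP=0$, and $\mathcal{A}_{12}M=\{0\}$ implies $QM=0$. *)

theory Defs
  imports Complex_Main
begin

locale unital_algebra = vector_space scale
  for scale :: "'f::field \<Rightarrow> 'a::ring_1 \<Rightarrow> 'a" (infixr \<open>*s\<close> 75) +
  assumes scale_mult_left: "(c *s x) * y = c *s (x * y)"
    and scale_mult_right: "x * (c *s y) = c *s (x * y)"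

definition normalized_linear_sequence ::
    "('f::field \<Rightarrow> 'a::ring_1 \<Rightarrow> 'a) \<Rightarrow> (nat \<Rightarrow> 'a \<Rightarrow> 'a) \<Rightarrow> bool" where
  "normalized_linear_sequence scale d \<longleftrightarrow>
     (\<forall>n. Vector_Spaces.linear scale scale (d n)) \<and> d 0 = id"

definition jordan_higher_identity ::
    "(nat \<Rightarrow> 'a::ring_1 \<Rightarrow> 'a) \<Rightarrow> nat \<Rightarrow> 'a \<Rightarrow> 'a \<Rightarrow> bool" where
  "jordan_higher_identity d n A B \<longleftrightarrow>
     d n (A * B + B * A) = (\<Sum>(i, j) | i + j = n. d i A * d j B + d i B * d j A)"

definition jordan_higher_derivation ::
    "('f::field \<Rightarrow> 'a::ring_1 \<Rightarrow> 'a) \<Rightarrow> (nat \<Rightarrow> 'a \<Rightarrow> 'a) \<Rightarrow> bool" where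
  "jordan_higher_derivation scale d \<longleftrightarrow>
     normalized_linear_sequence scale d \<and> (\<forall>n A B. jordan_higher_identity d n A B)"

definition jordan_higher_derivable_at ::
    "('f::field \<Rightarrow> 'a::ring_1 \<Rightarrow> 'a) \<Rightarrow> (nat \<Rightarrow> 'a \<Rightarrow> 'a) \<Rightarrow> 'a \<Rightarrow> bool" where
  "jordan_higher_derivable_at scale d C \<longleftrightarrow>
     normalized_linear_sequence scale d \<and>
     (\<forall>n A B. A * B = C \<longrightarrow> jordan_higher_identity d n A B)"

definition jordan_higher_all_derivable_point ::
    "('f::field \<Rightarrow> 'a::ring_1 \<Rightarrow> 'a) \<Rightarrow> 'a \<Rightarrow> bool" where
  "jordan_higher_all_derivable_point scale C \<longleftrightarrow>
     (\<forall>d. jordan_higher_derivable_at scale d C \<longrightarrow> jordan_higher_derivation scale d)"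

definition peirce :: "'a::ring_1 \<Rightarrow> 'a \<Rightarrow> 'a set" where
  "peirce E F = {E * X * F | X. True}"

definition corner_invertibles :: "'a::ring_1 \<Rightarrow> 'a set" where
  "corner_invertibles E = {X \<in> peirce E E. \<exists>Y \<in> peirce E E. X * Y = E \<and> Y * X = E}"

definition faithful_peirce12 :: "'a::ring_1 \<Rightarrow> bool" where
  "faithful_peirce12 P \<longleftrightarrow>
     (let Q = 1 - P; A12 = peirce P Q in
      \<forall>M. ((\<lambda>X. M * X) ` A12 = {0} \<longrightarrow> M * P = 0) \<and>
          ((\<lambda>X. X * M) ` A12 = {0} \<longrightarrow> Q * M = 0))"

definition algebra_center :: "'a::ring_1 set" where
  "algebra_center = {M. \<forall>A. A * M = M * A}"

end

theory Submission
  imports Defs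
begin

text \<open>Write \<open>J\<^sub>d(A,B) = d(A \<circle> B) - d(A) \<circle> B - A \<circle> d(B)\<close> for the Jordan product
  \<open>A \<circle> B = AB + BA\<close>; it is bilinear in \<open>A\<close> and \<open>B\<close>.

  Reduction to one map: define \<open>e\<^sub>n\<close> by \<open>(n+1) d\<^sub>n\<^sub>+\<^sub>1 = \<Sum>\<^sub>k\<^sub>\<le>\<^sub>n e\<^sub>k d\<^sub>n\<^sub>-\<^sub>k\<close>. If \<open>d\<close> is Jordan
  higher derivable at \<open>C\<close>, then inductively each \<open>e\<^sub>n\<close> is Jordan derivable at \<open>C\<close>; once all \<open>e\<^sub>n\<close>
  are Jordan derivations, the recursion makes \<open>d\<close> a Jordan higher derivation.

  One map: with \<open>C = a + c + b\<close> in Peirce components, the factorizations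
  \<open>C = (x + m + by\<inverse>)(x\<inverse>(a + c) - x\<inverse>my + y)\<close>, where \<open>x\<close>, \<open>y\<close> are invertible in the corners, may be
  rescaled in \<open>x\<close>, \<open>m\<close>, \<open>y\<close>. Comparing coefficients gives \<open>J\<^sub>d(x,y) = 0\<close> and
  \<open>J\<^sub>d(xm,y) = J\<^sub>d(x,my)\<close>. Up to an inner derivation \<open>d\<close> then preserves the Peirce components, and
  faithfulness and the trivial centre make it a derivation plus \<open>\<mu> I\<close>. Hence
  \<open>J\<^sub>d(A,B) = -\<mu> (A \<circle> B)\<close>. If \<open>\<mu> \<noteq> 0\<close>, the pair \<open>(1,C)\<close> forces \<open>C = 0\<close>, and then the pairs \<open>(m,P)\<close>
  force \<open>P A Q = 0\<close>, contradicting faithfulness.\<close>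

section \<open>Jordan products and defects\<close>

definition jordan_prod :: "'a::ring_1 \<Rightarrow> 'a \<Rightarrow> 'a" (infixl \<open>\<circle>\<close> 70) where
  "A \<circle> B = A * B + B * A"

definition jordan_defect :: "('a::ring_1 \<Rightarrow> 'a) \<Rightarrow> 'a \<Rightarrow> 'a \<Rightarrow> 'a" where
  "jordan_defect d A B = d (A \<circle> B) - (d A \<circle> B + A \<circle> d B)"

definition higher_defect :: "(nat \<Rightarrow> 'a::ring_1 \<Rightarrow> 'a) \<Rightarrow> nat \<Rightarrow> 'a \<Rightarrow> 'a \<Rightarrow> 'a" where
  "higher_defect d n A B = d n (A \<circle> B) - (\<Sum>i\<le>n. d i A \<circle> d (n - i) B)"

lemma jordan_prod_commute: "A \<circle> B = B \<circle> A"
  by (simp add: jordan_prod_def add.commute)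

lemma jordan_prod_add_left: "(A + B) \<circle> D = A \<circle> D + B \<circle> D"
  by (simp add: jordan_prod_def algebra_simps)

lemma jordan_prod_add_right: "D \<circle> (A + B) = D \<circle> A + D \<circle> B"
  by (simp add: jordan_prod_def algebra_simps)

lemma jordan_prod_sum_left: "sum f I \<circle> D = (\<Sum>i\<in>I. f i \<circle> D)"
  by (simp add: jordan_prod_def sum_distrib_left sum_distrib_right sum.distrib)

text \<open>Reversing the sum of the terms \<open>d i B * d (n - i) A\<close> pairs each term
  \<open>d i A * d (n - i) B\<close> with its opposite product, so the two halves combine into
  Jordan products.\<close>

lemma jordan_higher_identity_iff: "jordan_higher_identity d n A B \<longleftrightarrow> higher_defect d n A B = 0"
proof -
  have *: "(\<Sum>(i, j) | i + j = n. f i j) = (\<Sum>i\<le>n. f i (n - i))" for f :: "nat \<Rightarrow> nat \<Rightarrow> 'a"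
    by (rule sum.reindex_bij_witness[where i = "\<lambda>i. (i, n - i)" and j = fst]) auto
  have "(\<Sum>i\<le>n. d i B * d (n - i) A) = (\<Sum>i\<le>n. d (n - i) B * d i A)"
    by (subst sum.nat_diff_reindex[where n = "Suc n", simplified lessThan_Suc_atMost, symmetric])
       (auto intro!: sum.cong)
  then show ?thesis
    by (simp add: jordan_higher_identity_def higher_defect_def * sum.distrib jordan_prod_def)
qed

lemma peirce_iff:
  assumes "E * E = E" and "F * F = F"
  shows "X \<in> peirce E F \<longleftrightarrow> E * X = X \<and> X * F = X"
proof
  assume "X \<in> peirce E F"
  then obtain Y where "X = E * Y * F" by (auto simp: peirce_def)
  then show "E * X = X \<and> X * F = X"
    using assms by (metis mult.assoc)
next
  assume "E * X = X \<and> X * F = X"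
  then have "X = E * X * F" by simp
  then show "X \<in> peirce E F" unfolding peirce_def by blast
qed

lemma jordan_defect_diff:
  "jordan_defect (\<lambda>z. f z - g z) A B = jordan_defect f A B - jordan_defect g A B"
  by (simp add: jordan_defect_def jordan_prod_def algebra_simps)

lemma jordan_defect_inner: "jordan_defect (\<lambda>z. z * k - k * z) A B = 0"
  by (simp add: jordan_defect_def jordan_prod_def algebra_simps)

section \<open>Reduction of a sequence to its generators\<close>

locale unital_algebra_char_0 = unital_algebra scale
  for scale :: "'f::field_char_0 \<Rightarrow> 'a::ring_1 \<Rightarrow> 'a" (infixr \<open>*s\<close> 75)
begin

lemma jordan_prod_scale_left: "(c *s A) \<circle> B = c *s (A \<circle> B)"
  by (simp add: jordan_prod_def scale_mult_left scale_mult_right scale_right_distrib)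

lemma jordan_prod_scale_right: "A \<circle> (c *s B) = c *s (A \<circle> B)"
  by (simp add: jordan_prod_def scale_mult_left scale_mult_right scale_right_distrib)

text \<open>Coefficients of a logarithmic derivative: for the formal series
  \<open>D(t) = sum d_n t^n\<close> and \<open>E(t) = sum e_n t^n\<close> the recursion is
  \<open>D' = E D\<close>, with composition as product. When \<open>d 0 = id\<close>, the term
  \<open>k = n\<close> is \<open>e_n\<close> itself, so the equation can be solved for it.\<close>

fun generator :: "(nat \<Rightarrow> 'a \<Rightarrow> 'a) \<Rightarrow> nat \<Rightarrow> 'a \<Rightarrow> 'a" where
  "generator d n x = of_nat (Suc n) *s d (Suc n) x - (\<Sum>k<n. generator d k (d (n - k) x))"

declare generator.simps [simp del]

lemma scale_eq_sum_generator:
  assumes "d 0 = id"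
  shows "of_nat (Suc n) *s d (Suc n) x = (\<Sum>k\<le>n. generator d k (d (n - k) x))"
  using assms by (simp add: generator.simps[of d n] flip: lessThan_Suc_atMost)

lemma linear_generator:
  assumes "\<And>n. module_hom scale scale (d n)"
  shows "module_hom scale scale (generator d n)"
proof (induction n rule: less_induct)
  case (less n)
  interpret module_pair scale scale ..
  have "module_hom scale scale (\<lambda>x. generator d k (d (n - k) x))" if "k < n" for k
    using module_hom_compose[OF assms less[OF that]] by (simp add: o_def)
  then have "module_hom scale scale
      (\<lambda>x. of_nat (Suc n) *s d (Suc n) x - (\<Sum>k<n. generator d k (d (n - k) x)))"
    by (intro module_hom_sub module_hom_scale module_hom_sum assms)
       (auto intro: module_axioms)
  also have "(\<lambda>x. of_nat (Suc n) *s d (Suc n) x - (\<Sum>k<n. generator d k (d (n - k) x))) = generator d n"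
    by (rule ext) (simp only: generator.simps[of d n])
  finally show ?case .
qed

text \<open>This is the coefficient of \<open>t^n\<close> in the product rule for the derivative of
  \<open>D(t) A \<circle> D(t) B\<close>, after replacing \<open>D'\<close> by \<open>E D\<close> in
  each factor.\<close>

lemma scale_jordan_convolution:
  assumes "d 0 = id"
  shows "of_nat (Suc n) *s (\<Sum>i\<le>Suc n. d i A \<circle> d (Suc n - i) B) =
    (\<Sum>k\<le>n. \<Sum>i\<le>n - k. generator d k (d i A) \<circle> d (n - k - i) B
                        + d i A \<circle> generator d k (d (n - k - i) B))"
proof -
  \<comment> \<open>The weight \<open>i\<close> is what differentiating the left factor alone
    produces; the term \<open>i = 0\<close> drops out, which accounts for the index shift.\<close>
  have half: "(\<Sum>i\<le>Suc n. of_nat i *s (d i A \<circle> d (Suc n - i) B)) =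
      (\<Sum>k\<le>n. \<Sum>i\<le>n - k. generator d k (d i A) \<circle> d (n - k - i) B)" for A B
  proof -
    have "(\<Sum>i\<le>Suc n. of_nat i *s (d i A \<circle> d (Suc n - i) B)) =
        (\<Sum>i\<le>n. (of_nat (Suc i) *s d (Suc i) A) \<circle> d (n - i) B)"
      by (subst sum.atMost_Suc_shift) (simp add: jordan_prod_scale_left del: of_nat_Suc)
    also have "\<dots> = (\<Sum>i\<le>n. \<Sum>k\<le>i. generator d k (d (i - k) A) \<circle> d (n - i) B)"
      by (simp only: scale_eq_sum_generator[of d, OF assms] jordan_prod_sum_left)
    \<comment> \<open>The summand must depend on \<open>k\<close> and \<open>i - k\<close> only
      before the triangle can be reindexed.\<close>
    also have "\<dots> = (\<Sum>i\<le>n. \<Sum>k\<le>i. generator d k (d (i - k) A) \<circle> d (n - k - (i - k)) B)"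
      by (intro sum.cong) auto
    also have "\<dots> = (\<Sum>(k, i) | k + i \<le> n. generator d k (d i A) \<circle> d (n - k - i) B)"
      by (rule sum.triangle_reindex_eq[symmetric])
    also have "{(k, i). k + i \<le> n} = (SIGMA k:{..n}. {..n - k})"
      by auto
    finally show ?thesis
      by (simp add: sum.Sigma)
  qed
  \<comment> \<open>The factor \<open>n + 1\<close> splits as \<open>i + (n + 1 - i)\<close>;
    reversing the second sum turns it into \<open>half\<close> with \<open>A\<close> and
    \<open>B\<close> exchanged.\<close>
  have "of_nat (Suc n) *s (\<Sum>i\<le>Suc n. d i A \<circle> d (Suc n - i) B) =
      (\<Sum>i\<le>Suc n. of_nat i *s (d i A \<circle> d (Suc n - i) B)) +
      (\<Sum>i\<le>Suc n. of_nat (Suc n - i) *s (d (Suc n - i) B \<circle> d i A))"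
    unfolding scale_sum_right sum.distrib[symmetric]
  proof (rule sum.cong[OF refl])
    fix i assume "i \<in> {..Suc n}"
    then have "(of_nat (Suc n) :: 'f) = of_nat i + of_nat (Suc n - i)"
      by (metis atMost_iff le_add_diff_inverse of_nat_add)
    then show "of_nat (Suc n) *s (d i A \<circle> d (Suc n - i) B) =
        of_nat i *s (d i A \<circle> d (Suc n - i) B) +
        of_nat (Suc n - i) *s (d (Suc n - i) B \<circle> d i A)"
      by (simp only: scale_left_distrib jordan_prod_commute)
  qed
  also have "(\<Sum>i\<le>Suc n. of_nat (Suc n - i) *s (d (Suc n - i) B \<circle> d i A)) =
      (\<Sum>i\<le>Suc n. of_nat i *s (d i B \<circle> d (Suc n - i) A))"
    by (rule sum.reindex_bij_witness[where i = "\<lambda>i. Suc n - i" and j = "\<lambda>i. Suc n - i"]) auto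
  also have "(\<Sum>i\<le>Suc n. of_nat i *s (d i B \<circle> d (Suc n - i) A)) =
      (\<Sum>k\<le>n. \<Sum>i\<le>n - k. generator d k (d i B) \<circle> d (n - k - i) A)"
    by (rule half)
  also have "\<dots> = (\<Sum>k\<le>n. \<Sum>i\<le>n - k. d i A \<circle> generator d k (d (n - k - i) B))"
  proof (rule sum.cong[OF refl])
    fix k
    show "(\<Sum>i\<le>n - k. generator d k (d i B) \<circle> d (n - k - i) A) =
        (\<Sum>i\<le>n - k. d i A \<circle> generator d k (d (n - k - i) B))"
      by (rule sum.reindex_bij_witness[where i = "\<lambda>i. n - k - i" and j = "\<lambda>i. n - k - i"])
         (auto simp: jordan_prod_commute simp del: diff_diff_left)
  qed
  finally show ?thesis
    by (simp only: half sum.distrib)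
qed

text \<open>Subtracting the product rule from \<open>D' = E D\<close> at
  \<open>A \<circle> B\<close> expresses order \<open>n + 1\<close> through higher defects of order
  at most \<open>n\<close> and defects of the generators. Both inductions below rest on this
  formula.\<close>

lemma scale_higher_defect:
  assumes "d 0 = id" and "\<And>n. module_hom scale scale (d n)"
  shows "of_nat (Suc n) *s higher_defect d (Suc n) A B =
    (\<Sum>k\<le>n. generator d k (higher_defect d (n - k) A B)
      + (\<Sum>i\<le>n - k. jordan_defect (generator d k) (d i A) (d (n - k - i) B)))"
proof -
  have "generator d k (higher_defect d m A B)
      + (\<Sum>i\<le>m. jordan_defect (generator d k) (d i A) (d (m - i) B)) =
      generator d k (d m (A \<circle> B)) -
      (\<Sum>i\<le>m. generator d k (d i A) \<circle> d (m - i) B + d i A \<circle> generator d k (d (m - i) B))" for k m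
  proof -
    interpret g: module_hom scale scale "generator d k"
      by (rule linear_generator[OF assms(2)])
    show ?thesis
      by (simp add: higher_defect_def jordan_defect_def g.diff g.sum sum_subtractf)
  qed
  then show ?thesis
    by (simp only: higher_defect_def[of d "Suc n"] scale_right_diff_distrib scale_jordan_convolution[of d, OF assms(1)]
        scale_eq_sum_generator[of d, OF assms(1)] sum_subtractf)
qed

theorem jordan_higher_all_derivable_pointI:
  assumes derivable: "\<And>\<delta>. module_hom scale scale \<delta> \<Longrightarrow>
      (\<And>A B. A * B = C \<Longrightarrow> jordan_defect \<delta> A B = 0) \<Longrightarrow> (\<And>A B. jordan_defect \<delta> A B = 0)"
  shows "jordan_higher_all_derivable_point scale C"
  unfolding jordan_higher_all_derivable_point_def
proof (intro allI impI)
  fix d assume at_C: "jordan_higher_derivable_at scale d C"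
  then have d: "d 0 = id" "\<And>n. module_hom scale scale (d n)"
    by (auto simp: jordan_higher_derivable_at_def normalized_linear_sequence_def module_hom_iff_linear)
  have defect_C: "higher_defect d n A B = 0" if "A * B = C" for n A B
    using at_C that by (simp add: jordan_higher_derivable_at_def jordan_higher_identity_iff)
  have gen0: "generator d n 0 = 0" for n
    by (rule module_hom.zero[OF linear_generator[OF d(2)]])
  have gen: "jordan_defect (generator d n) A B = 0" for n A B
  proof (induction n arbitrary: A B rule: less_induct)
    case (less n)
    show ?case
    proof (rule derivable[OF linear_generator[OF d(2)]])
      fix A B assume "A * B = C"
      then have "0 = (\<Sum>k\<le>n. \<Sum>i\<le>n - k. jordan_defect (generator d k) (d i A) (d (n - k - i) B))"
        using scale_higher_defect[of d n A B, OF d] by (simp add: defect_C gen0)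
      \<comment> \<open>The pairs \<open>d i A\<close>, \<open>d (n - k - i) B\<close> need not
        multiply to \<open>C\<close>, so for \<open>k < n\<close> the induction hypothesis is used
        for arbitrary arguments. At \<open>k = n\<close> only \<open>i = 0\<close> remains, where
        \<open>d 0 = id\<close>.\<close>
      also have "\<dots> = jordan_defect (generator d n) A B"
        by (subst lessThan_Suc_atMost[symmetric]) (simp add: less d(1))
      finally show "jordan_defect (generator d n) A B = 0" by simp
    qed
  qed
  have "higher_defect d n A B = 0" for n A B
  proof (induction n rule: less_induct)
    case (less n)
    show ?case
    proof (cases n)
      case 0
      then show ?thesis by (simp add: higher_defect_def d(1))
    next
      case (Suc m)
      \<comment> \<open>Only generators applied to higher defects of smaller order are left, and
        these vanish by induction; characteristic zero then cancels the factor.\<close>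
      then have "of_nat (Suc m) *s higher_defect d n A B = 0"
        using scale_higher_defect[of d m A B, OF d] less by (simp add: gen gen0)
      then show ?thesis by (simp add: scale_eq_0_iff del: of_nat_Suc)
    qed
  qed
  then show "jordan_higher_derivation scale d"
    using at_C by (simp add: jordan_higher_derivation_def jordan_higher_derivable_at_def
        jordan_higher_identity_iff)
qed

section \<open>Bilinearity of the defect of a linear map\<close>

lemma jordan_defect_add_left:
  assumes "module_hom scale scale d"
  shows "jordan_defect d (A + B) D = jordan_defect d A D + jordan_defect d B D"
  using module_hom.add[OF assms]
  by (simp add: jordan_defect_def jordan_prod_add_left jordan_prod_add_right)

lemma jordan_defect_add_right:
  assumes "module_hom scale scale d"
  shows "jordan_defect d D (A + B) = jordan_defect d D A + jordan_defect d D B"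
  using module_hom.add[OF assms]
  by (simp add: jordan_defect_def jordan_prod_add_left jordan_prod_add_right)

lemma jordan_defect_scale_left:
  assumes "module_hom scale scale d"
  shows "jordan_defect d (c *s A) B = c *s jordan_defect d A B"
  using module_hom.scale[OF assms]
  by (simp add: jordan_defect_def jordan_prod_scale_left jordan_prod_scale_right
      scale_right_distrib scale_right_diff_distrib)

lemma jordan_defect_scale_right:
  assumes "module_hom scale scale d"
  shows "jordan_defect d A (c *s B) = c *s jordan_defect d A B"
  using module_hom.scale[OF assms]
  by (simp add: jordan_defect_def jordan_prod_scale_left jordan_prod_scale_right
      scale_right_distrib scale_right_diff_distrib)

lemma jordan_defect_diff_right:
  assumes "module_hom scale scale d"
  shows "jordan_defect d D (A - B) = jordan_defect d D A - jordan_defect d D B"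
  using jordan_defect_add_right[OF assms, of D "A - B" B] by simp

text \<open>The Leibniz part counts \<open>c\<close> twice and the image of the product only once.
  This is the obstruction excluded at the end.\<close>

lemma jordan_defect_scaling: "jordan_defect (\<lambda>z. c *s z) A B = - (c *s (A \<circle> B))"
  by (simp add: jordan_defect_def jordan_prod_def scale_mult_left scale_mult_right scale_right_distrib)

lemma peirce_scale:
  assumes "X \<in> peirce E F"
  shows "c *s X \<in> peirce E F"
proof -
  from assms obtain Y where "X = E * Y * F" by (auto simp: peirce_def)
  then have "c *s X = E * (c *s Y) * F" by (simp add: scale_mult_left scale_mult_right)
  then show ?thesis unfolding peirce_def by blast
qed

lemma double_eq_0_iff: "x + x = 0 \<longleftrightarrow> (x :: 'a) = 0"
proof -
  have "x + x = 2 *s x"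
    using scale_left_distrib[of 1 1 x] by simp
  then show ?thesis by simp
qed

end

section \<open>Peirce calculus and factorizations in a triangular algebra\<close>

locale triangular_algebra = unital_algebra_char_0 scale
  for scale :: "'f::field_char_0 \<Rightarrow> 'a::ring_1 \<Rightarrow> 'a" (infixr \<open>*s\<close> 75) +
  fixes P Q :: 'a
  assumes idem_P: "P * P = P"
    and Q_def: "Q = 1 - P"
    and P_nonzero: "P \<noteq> 0"
    and span_P: "peirce P P \<subseteq> span (corner_invertibles P)"
    and span_Q: "peirce Q Q \<subseteq> span (corner_invertibles Q)"
    and faithful: "faithful_peirce12 P"
    and peirce_QP: "peirce Q P = {0}"
    and center: "algebra_center = range (\<lambda>c. c *s (1 :: 'a))"
begin

lemma idem_Q: "Q * Q = Q"
  by (simp add: Q_def algebra_simps idem_P)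

lemma PQ: "P * Q = 0" and QP: "Q * P = 0"
  by (simp_all add: Q_def algebra_simps idem_P)

lemma Q_mult_P: "Q * (X * P) = 0"
  using peirce_QP unfolding peirce_def by (auto simp: mult.assoc)

lemmas corner_iff = peirce_iff[OF idem_P idem_P] peirce_iff[OF idem_P idem_Q] peirce_iff[OF idem_Q idem_Q]

lemma peirce_PP_simps:
  assumes "x \<in> peirce P P"
  shows "P * x = x" "x * P = x" "Q * x = 0" "x * Q = 0"
    and "P * (x * z) = x * z" "x * (P * z) = x * z" "Q * (x * z) = 0" "x * (Q * z) = 0"
proof -
  show *: "P * x = x" "x * P = x"
    using assms by (auto simp: corner_iff)
  show **: "Q * x = 0" "x * Q = 0"
    by (simp_all add: Q_def algebra_simps *)
  show "P * (x * z) = x * z" "x * (P * z) = x * z" "Q * (x * z) = 0" "x * (Q * z) = 0"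
    by (simp_all only: mult.assoc[symmetric] * ** mult_zero_left)
qed

lemma peirce_PQ_simps:
  assumes "m \<in> peirce P Q"
  shows "P * m = m" "m * Q = m" "Q * m = 0" "m * P = 0"
    and "P * (m * z) = m * z" "m * (Q * z) = m * z" "Q * (m * z) = 0" "m * (P * z) = 0"
proof -
  show *: "P * m = m" "m * Q = m"
    using assms by (auto simp: corner_iff)
  show **: "Q * m = 0" "m * P = 0"
    using *(1)[symmetric] *(2) PQ QP by (metis mult.assoc mult_zero_left mult_zero_right)+
  show "P * (m * z) = m * z" "m * (Q * z) = m * z" "Q * (m * z) = 0" "m * (P * z) = 0"
    by (simp_all only: mult.assoc[symmetric] * ** mult_zero_left)
qed

lemma peirce_QQ_simps:
  assumes "y \<in> peirce Q Q"
  shows "Q * y = y" "y * Q = y" "P * y = 0" "y * P = 0"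
    and "Q * (y * z) = y * z" "y * (Q * z) = y * z" "P * (y * z) = 0" "y * (P * z) = 0"
proof -
  show *: "Q * y = y" "y * Q = y"
    using assms by (auto simp: corner_iff)
  show **: "P * y = 0" "y * P = 0"
    using *(1)[symmetric] *(2) PQ QP by (metis mult.assoc mult_zero_left mult_zero_right)+
  show "Q * (y * z) = y * z" "y * (Q * z) = y * z" "P * (y * z) = 0" "y * (P * z) = 0"
    by (simp_all only: mult.assoc[symmetric] * ** mult_zero_left)
qed

lemmas peirce_simps = peirce_PP_simps peirce_PQ_simps peirce_QQ_simps

lemma peirce_zero_products:
  shows "x \<in> peirce P P \<Longrightarrow> y \<in> peirce Q Q \<Longrightarrow> x * y = 0"
    and "x \<in> peirce P P \<Longrightarrow> y \<in> peirce Q Q \<Longrightarrow> y * x = 0"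
    and "x \<in> peirce P P \<Longrightarrow> m \<in> peirce P Q \<Longrightarrow> m * x = 0"
    and "y \<in> peirce Q Q \<Longrightarrow> m \<in> peirce P Q \<Longrightarrow> y * m = 0"
    and "m \<in> peirce P Q \<Longrightarrow> n \<in> peirce P Q \<Longrightarrow> m * n = 0"
  by (metis peirce_simps(1-4,9-12,17-20) mult.assoc mult_zero_left mult_zero_right)+

lemma peirce_products:
  shows "x \<in> peirce P P \<Longrightarrow> x' \<in> peirce P P \<Longrightarrow> x * x' \<in> peirce P P"
    and "y \<in> peirce Q Q \<Longrightarrow> y' \<in> peirce Q Q \<Longrightarrow> y * y' \<in> peirce Q Q"
    and "x \<in> peirce P P \<Longrightarrow> m \<in> peirce P Q \<Longrightarrow> x * m \<in> peirce P Q"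
    and "y \<in> peirce Q Q \<Longrightarrow> m \<in> peirce P Q \<Longrightarrow> m * y \<in> peirce P Q"
  by (simp_all add: corner_iff mult.assoc) (simp_all add: mult.assoc[symmetric])

lemma P_in: "P \<in> peirce P P" and Q_in: "Q \<in> peirce Q Q"
  by (simp_all add: corner_iff idem_P idem_Q)

lemma peirce_sum: "z = P * (z * P) + P * (z * Q) + Q * (z * Q)"
proof -
  have "z = (P + Q) * z * (P + Q)"
    by (simp add: Q_def)
  also have "\<dots> = P * (z * P) + P * (z * Q) + Q * (z * Q)"
    using Q_mult_P[of z] by (simp add: algebra_simps)
  finally show ?thesis .
qed

lemma peirce_decomposition:
  obtains x m y where "x \<in> peirce P P" "m \<in> peirce P Q" "y \<in> peirce Q Q" "z = x + m + y"
proof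
  show "P * (z * P) \<in> peirce P P" "P * (z * Q) \<in> peirce P Q" "Q * (z * Q) \<in> peirce Q Q"
    by (auto simp: peirce_def mult.assoc)
qed (rule peirce_sum)

lemma zero_in_peirce: "0 \<in> peirce E F"
  unfolding peirce_def by (auto intro: exI[of _ 0])

text \<open>Pointwise form of faithfulness: as \<open>0\<close> lies in \<open>peirce P Q\<close>,
  annihilating every element makes the image exactly \<open>{0}\<close>.\<close>

lemma faithful_left:
  assumes "x \<in> peirce P P" and "\<And>m. m \<in> peirce P Q \<Longrightarrow> x * m = 0"
  shows "x = 0"
proof -
  have "(\<lambda>X. x * X) ` peirce P Q = {0}"
    using assms(2) zero_in_peirce[of P Q] by force
  then have "x * P = 0"
    using faithful unfolding faithful_peirce12_def Let_def Q_def by blast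
  then show ?thesis using assms(1) by (simp add: peirce_simps)
qed

lemma faithful_right:
  assumes "y \<in> peirce Q Q" and "\<And>m. m \<in> peirce P Q \<Longrightarrow> m * y = 0"
  shows "y = 0"
proof -
  have "(\<lambda>X. X * y) ` peirce P Q = {0}"
    using assms(2) zero_in_peirce[of P Q] by force
  then have "Q * y = 0"
    using faithful unfolding faithful_peirce12_def Let_def Q_def by blast
  then show ?thesis using assms(1) by (simp add: peirce_simps)
qed

text \<open>Since \<open>b\<close> is absorbed into the left factor and \<open>a\<close> into the right factor, no
  invertibility of \<open>C\<close> is needed.\<close>

lemma factorization:
  assumes x: "x \<in> peirce P P" "x' \<in> peirce P P" "x * x' = P"
    and y: "y \<in> peirce Q Q" "y' \<in> peirce Q Q" "y' * y = Q"
    and m: "m \<in> peirce P Q"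
    and C: "a \<in> peirce P P" "c \<in> peirce P Q" "b \<in> peirce Q Q"
  shows "(x + m + b * y') * (x' * (a + c) - x' * (m * y) + y) = a + c + b"
proof -
  have "x * (x' * z) = P * z" "y' * (y * z) = Q * z" for z
    by (simp_all add: mult.assoc[symmetric] x y)
  then show ?thesis
    using assms
    by (simp add: distrib_left distrib_right left_diff_distrib right_diff_distrib mult.assoc
        peirce_products peirce_simps peirce_zero_products)
qed

section \<open>Vanishing of the defect across the diagonal corners\<close>

text \<open>Scaling \<open>x\<close>, \<open>x * m\<close>, \<open>y\<close> by \<open>s\<close>,
  \<open>t\<close>, \<open>r\<close> in \<open>factorization\<close> makes the defect a Laurent
  polynomial that vanishes for all nonzero \<open>s\<close>, \<open>r\<close> and all
  \<open>t\<close>. A few values of the parameters isolate the coefficients.\<close>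

lemma jordan_defect_invertibles:
  assumes d: "module_hom scale scale d"
    and at_C: "\<And>A B. A * B = C \<Longrightarrow> jordan_defect d A B = 0"
    and x: "x \<in> corner_invertibles P" and y: "y \<in> corner_invertibles Q"
    and m: "m \<in> peirce P Q"
  shows "jordan_defect d x y = 0" and "jordan_defect d (x * m) y = jordan_defect d x (m * y)"
proof -
  let ?J = "jordan_defect d"
  obtain x' where x': "x \<in> peirce P P" "x' \<in> peirce P P" "x * x' = P" "x' * x = P"
    using x by (auto simp: corner_invertibles_def)
  obtain y' where y': "y \<in> peirce Q Q" "y' \<in> peirce Q Q" "y' * y = Q"
    using y by (auto simp: corner_invertibles_def)
  obtain a c b where C: "a \<in> peirce P P" "c \<in> peirce P Q" "b \<in> peirce Q Q" "C = a + c + b"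
    by (rule peirce_decomposition)
  define g where "g = x' * (a + c)"
  \<comment> \<open>This form comes from putting \<open>u = x * m\<close> in place of
    \<open>m\<close> in the factorization.\<close>
  define n where "n = x' * (x * m * y)"
  have n: "n = m * y"
    using x' m by (simp add: n_def mult.assoc[symmetric] peirce_simps)
  define u where "u = x * m"
  have u: "u \<in> peirce P Q" using x' m by (simp add: u_def peirce_products)
  have expand: "(s * r) *s ?J x y + (?J x g + ?J (b * y') y) + (1 / (s * r)) *s ?J (b * y') g
      + t *s (r *s (?J u y - ?J x n) + (1 / s) *s (?J u g - ?J (b * y') n)
      - (t * r / s) *s ?J u n) = 0" if "s \<noteq> 0" "r \<noteq> 0" for s r t
  proof -
    have "(s *s x + t *s u + b * ((1 / r) *s y')) *
        (((1 / s) *s x') * (a + c) - ((1 / s) *s x') * ((t *s u) * (r *s y)) + r *s y) = a + c + b"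
      using that x' y' u C
      by (intro factorization peirce_scale) (simp_all add: scale_mult_left scale_mult_right)
    then have "?J (s *s x + t *s u + (1 / r) *s (b * y'))
        ((1 / s) *s g + (- (t * r / s)) *s n + r *s y) = 0"
      by (intro at_C) (simp add: C g_def n_def u_def scale_mult_left scale_mult_right mult.assoc mult.commute)
    then show ?thesis
      using that
      by (simp add: jordan_defect_add_left[OF d] jordan_defect_add_right[OF d]
          jordan_defect_diff_right[OF d] jordan_defect_scale_left[OF d] jordan_defect_scale_right[OF d]
          scale_right_distrib scale_right_diff_distrib algebra_simps)
  qed
  \<comment> \<open>With \<open>t = 0\<close> only the powers 1, 0 and -1 of \<open>s * r\<close>
    occur; the values 1, -1 and 2 separate them.\<close>
  have 1: "?J x y + (?J x g + ?J (b * y') y) + ?J (b * y') g = 0"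
    using expand[of 1 1 0] by simp
  have 2: "- ?J x y + (?J x g + ?J (b * y') y) - ?J (b * y') g = 0"
    using expand[of "-1" 1 0] by simp
  have 3: "2 *s ?J x y + (?J x g + ?J (b * y') y) + (1 / 2) *s ?J (b * y') g = 0"
    using expand[of 2 1 0] by simp
  define X Y Z where "X = ?J x y" and "Y = ?J x g + ?J (b * y') y" and "Z = ?J (b * y') g"
  note XYZ = 1[folded X_def Y_def Z_def] 2[folded X_def Y_def Z_def] 3[folded X_def Y_def Z_def]
  have "Y + Y = (X + Y + Z) + (- X + Y - Z)" by simp
  also have "\<dots> = 0" by (simp only: XYZ add_0)
  finally have "Y = 0" by (simp only: double_eq_0_iff)
  then have "Z = - X" using XYZ(1) by (simp add: add_eq_0_iff)
  then have "(2 - 1 / 2) *s X = 0"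
    using XYZ(3) \<open>Y = 0\<close> by (simp add: scale_left_diff_distrib del: diff_divide_distrib)
  then have "X = 0" by simp
  then show "?J x y = 0" by (simp add: X_def)
  \<comment> \<open>With the part free of \<open>t\<close> gone, the coefficients of
    \<open>t * r\<close>, \<open>t / s\<close> and \<open>t * t * r / s\<close> are separated by
    choosing signs of \<open>r\<close> and \<open>t\<close>.\<close>
  define D E F where "D = ?J u y - ?J x n" and "E = ?J u g - ?J (b * y') n" and "F = ?J u n"
  have Z: "Z = 0" using \<open>Z = - X\<close> \<open>X = 0\<close> by simp
  note expand' = expand[folded X_def Y_def Z_def D_def E_def F_def, unfolded \<open>X = 0\<close> \<open>Y = 0\<close> Z]
  have 4: "D + E - F = 0"
    using expand'[of 1 1 1] by simp
  have 5: "- D - E - F = 0"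
    using expand'[of 1 1 "-1"] by (simp add: algebra_simps)
  have 6: "- D + E + F = 0"
    using expand'[of 1 "-1" 1] by (simp add: algebra_simps)
  have "E + E = (D + E - F) + (- D + E + F)" by simp
  also have "\<dots> = 0" by (simp only: 4 6 add_0)
  finally have "E = 0" by (simp only: double_eq_0_iff)
  have "F + F = - ((D + E - F) + (- D - E - F))" by simp
  also have "\<dots> = 0" by (simp only: 4 5 add_0 minus_zero)
  finally have "F = 0" by (simp only: double_eq_0_iff)
  then have "D = 0" using 4 \<open>E = 0\<close> by simp
  then show "?J (x * m) y = ?J x (m * y)" by (simp add: D_def u_def n)
qed

text \<open>For fixed \<open>m\<close> both claims are bilinear in \<open>x\<close> and
  \<open>y\<close>, so they extend from invertible elements to their spans, which contain the
  corners.\<close>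

lemma jordan_defect_corners:
  assumes d: "module_hom scale scale d"
    and at_C: "\<And>A B. A * B = C \<Longrightarrow> jordan_defect d A B = 0"
    and x: "x \<in> peirce P P" and y: "y \<in> peirce Q Q" and m: "m \<in> peirce P Q"
  shows "jordan_defect d x y = 0" and "jordan_defect d (x * m) y = jordan_defect d x (m * y)"
proof -
  let ?J = "jordan_defect d"
  note J_simps = jordan_defect_add_left[OF d] jordan_defect_add_right[OF d]
    jordan_defect_scale_left[OF d] jordan_defect_scale_right[OF d]
  have vanish: "f x y = 0"
    if f: "\<And>y. module_hom scale scale (\<lambda>x. f x y)" "\<And>x. module_hom scale scale (f x)"
      and 0: "\<And>x y. x \<in> corner_invertibles P \<Longrightarrow> y \<in> corner_invertibles Q \<Longrightarrow> f x y = 0"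
    for f
  proof -
    have "f x y = 0" if "x \<in> corner_invertibles P" for x
      by (rule module_hom.eq_0_on_span[OF f(2), where b = "corner_invertibles Q"])
         (use 0 that span_Q y in auto)
    then show ?thesis
      by (rule module_hom.eq_0_on_span[OF f(1), where b = "corner_invertibles P"])
         (use span_P x in auto)
  qed
  show "?J x y = 0"
    by (rule vanish) (simp_all add: module_hom_iff module_axioms J_simps
        jordan_defect_invertibles(1)[OF d at_C _ _ m])
  have "?J (x * m) y - ?J x (m * y) = 0"
    by (rule vanish) (simp_all add: module_hom_iff module_axioms J_simps distrib_left distrib_right
        scale_mult_left scale_mult_right scale_right_diff_distrib
        jordan_defect_invertibles(2)[OF d at_C _ _ m])
  then show "?J (x * m) y = ?J x (m * y)" by simp
qed

section \<open>Maps preserving the Peirce components\<close>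

text \<open>Comparing \<open>p * (x * m) = x * m * q\<close> with \<open>x * (p * m)\<close> gives
  \<open>(p * x - x * p) * m = 0\<close>, so \<open>p\<close> is central in its corner by
  faithfulness; \<open>q\<close> is treated symmetrically. Hence \<open>p + q\<close> is central,
  thus a scalar.\<close>

lemma central_corner_sum:
  assumes p: "p \<in> peirce P P" and q: "q \<in> peirce Q Q"
    and pq: "\<And>m. m \<in> peirce P Q \<Longrightarrow> p * m = m * q"
  obtains \<mu> where "p = \<mu> *s P" "q = \<mu> *s Q"
proof -
  have px: "p * x = x * p" if x: "x \<in> peirce P P" for x
  proof -
    have "p * x - x * p = 0"
    proof (rule faithful_left)
      show "p * x - x * p \<in> peirce P P"
        using x p by (simp add: corner_iff left_diff_distrib right_diff_distrib mult.assoc)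
             (simp add: mult.assoc[symmetric])
      fix m assume m: "m \<in> peirce P Q"
      then have "p * (x * m) = x * m * q" by (intro pq peirce_products x)
      then show "(p * x - x * p) * m = 0"
        using pq[OF m] by (simp add: left_diff_distrib mult.assoc)
    qed
    then show ?thesis by simp
  qed
  have qy: "q * y = y * q" if y: "y \<in> peirce Q Q" for y
  proof -
    have "q * y - y * q = 0"
    proof (rule faithful_right)
      show "q * y - y * q \<in> peirce Q Q"
        using y q by (simp add: corner_iff left_diff_distrib right_diff_distrib mult.assoc)
             (simp add: mult.assoc[symmetric])
      fix m assume m: "m \<in> peirce P Q"
      then have "p * (m * y) = m * y * q" by (intro pq peirce_products y)
      then show "m * (q * y - y * q) = 0"
        using pq[OF m] by (simp add: right_diff_distrib mult.assoc[symmetric])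
    qed
    then show ?thesis by simp
  qed
  have "z * (p + q) = (p + q) * z" for z
  proof -
    obtain x m y where z: "x \<in> peirce P P" "m \<in> peirce P Q" "y \<in> peirce Q Q" "z = x + m + y"
      by (rule peirce_decomposition)
    then show ?thesis
      using p q by (simp add: distrib_left distrib_right peirce_zero_products px qy pq)
  qed
  then have "p + q \<in> algebra_center"
    by (simp add: algebra_center_def)
  then obtain \<mu> where "p + q = \<mu> *s 1"
    using center by auto
  then have *: "P * (p + q) = P * (\<mu> *s 1)" "Q * (p + q) = Q * (\<mu> *s 1)" by simp_all
  have "p = \<mu> *s P"
    using *(1) p q by (simp add: distrib_left peirce_simps scale_mult_right)
  moreover have "q = \<mu> *s Q"
    using *(2) peirce_PP_simps(3)[OF p] peirce_QQ_simps(1)[OF q]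
    by (simp add: distrib_left scale_mult_right)
  ultimately show thesis by (rule that)
qed

text \<open>The rule inside a diagonal corner follows from the action on \<open>peirce P Q\<close>:
  expand \<open>f (x * z * m)\<close> in two ways and cancel \<open>m\<close> by faithfulness. All
  other products of components are given or vanish.\<close>

lemma derivationI:
  assumes f: "module_hom scale scale f"
    and corners: "\<And>x. x \<in> peirce P P \<Longrightarrow> f x \<in> peirce P P"
      "\<And>m. m \<in> peirce P Q \<Longrightarrow> f m \<in> peirce P Q"
      "\<And>y. y \<in> peirce Q Q \<Longrightarrow> f y \<in> peirce Q Q"
    and left: "\<And>x m. x \<in> peirce P P \<Longrightarrow> m \<in> peirce P Q \<Longrightarrow> f (x * m) = f x * m + x * f m"
    and right: "\<And>m y. m \<in> peirce P Q \<Longrightarrow> y \<in> peirce Q Q \<Longrightarrow> f (m * y) = f m * y + m * f y"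
  shows "f (u * v) = f u * v + u * f v"
proof -
  interpret f: module_hom scale scale f by (rule f)
  have xx: "f (x * z) = f x * z + x * f z" if xz: "x \<in> peirce P P" "z \<in> peirce P P" for x z
  proof -
    have "f (x * z) - (f x * z + x * f z) = 0"
    proof (rule faithful_left)
      show "f (x * z) - (f x * z + x * f z) \<in> peirce P P"
        using corners(1)[of "x * z"] corners(1)[of x] corners(1)[of z] xz
        by (simp add: peirce_products corner_iff distrib_left distrib_right left_diff_distrib right_diff_distrib mult.assoc)
           (simp add: mult.assoc[symmetric])
      fix m assume m: "m \<in> peirce P Q"
      have "f (x * (z * m)) = f x * (z * m) + x * (f z * m + z * f m)"
        using left xz m by (simp add: peirce_products)
      moreover have "f ((x * z) * m) = f (x * z) * m + x * z * f m"
        by (rule left) (use xz m in \<open>simp_all add: peirce_products\<close>)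
      ultimately show "(f (x * z) - (f x * z + x * f z)) * m = 0"
        by (simp add: algebra_simps)
    qed
    then show ?thesis by simp
  qed
  have yy: "f (y * z) = f y * z + y * f z" if yz: "y \<in> peirce Q Q" "z \<in> peirce Q Q" for y z
  proof -
    have "f (y * z) - (f y * z + y * f z) = 0"
    proof (rule faithful_right)
      show "f (y * z) - (f y * z + y * f z) \<in> peirce Q Q"
        using corners(3)[of "y * z"] corners(3)[of y] corners(3)[of z] yz
        by (simp add: peirce_products corner_iff distrib_left distrib_right left_diff_distrib right_diff_distrib mult.assoc)
           (simp add: mult.assoc[symmetric])
      fix m assume m: "m \<in> peirce P Q"
      have "f ((m * y) * z) = (f m * y + m * f y) * z + m * y * f z"
        using right yz m by (simp add: peirce_products)
      moreover have "f (m * (y * z)) = f m * (y * z) + m * f (y * z)"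
        by (rule right) (use yz m in \<open>simp_all add: peirce_products\<close>)
      ultimately show "m * (f (y * z) - (f y * z + y * f z)) = 0"
        by (simp add: algebra_simps)
    qed
    then show ?thesis by simp
  qed
  obtain x m y where u: "x \<in> peirce P P" "m \<in> peirce P Q" "y \<in> peirce Q Q" "u = x + m + y"
    by (rule peirce_decomposition)
  obtain x' m' y' where v: "x' \<in> peirce P P" "m' \<in> peirce P Q" "y' \<in> peirce Q Q" "v = x' + m' + y'"
    by (rule peirce_decomposition)
  show ?thesis
    using u(1-3) v(1-3)
    by (simp add: u(4) v(4) distrib_left distrib_right f.add peirce_zero_products corners
        xx yy left right)
qed

text \<open>Taking \<open>y = Q\<close> or \<open>x = P\<close> in \<open>balanced\<close> yields
  the product rules on \<open>peirce P Q\<close> up to correction terms in \<open>f Q\<close> and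
  \<open>f P\<close>. These are scalar multiples of \<open>Q\<close> and \<open>P\<close> with a
  common factor, and subtracting that scalar map leaves a derivation.\<close>

lemma jordan_defect_corner_preserving:
  assumes f: "module_hom scale scale f"
    and corners: "\<And>x. x \<in> peirce P P \<Longrightarrow> f x \<in> peirce P P"
      "\<And>m. m \<in> peirce P Q \<Longrightarrow> f m \<in> peirce P Q"
      "\<And>y. y \<in> peirce Q Q \<Longrightarrow> f y \<in> peirce Q Q"
    and balanced: "\<And>x m y. x \<in> peirce P P \<Longrightarrow> m \<in> peirce P Q \<Longrightarrow> y \<in> peirce Q Q \<Longrightarrow>
      jordan_defect f (x * m) y = jordan_defect f x (m * y)"
  shows "\<exists>\<mu>. \<forall>A B. jordan_defect f A B = - (\<mu> *s (A \<circle> B))"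
proof -
  interpret f: module_hom scale scale f by (rule f)
  note simps = jordan_defect_def jordan_prod_def peirce_simps peirce_products peirce_zero_products
    corners P_in Q_in
  have left: "f (x * m) + x * m * f Q = f x * m + x * f m"
    if "x \<in> peirce P P" "m \<in> peirce P Q" for x m
    using balanced[OF that Q_in] that
    by (simp add: simps algebra_simps)
  have right: "f (m * y) + f P * (m * y) = f m * y + m * f y"
    if "m \<in> peirce P Q" "y \<in> peirce Q Q" for m y
    using balanced[OF P_in that] that
    by (simp add: simps algebra_simps)
  have "f P * m = m * f Q" if "m \<in> peirce P Q" for m
    using left[OF P_in that] that by (simp add: simps)
  then obtain \<mu> where \<mu>: "f P = \<mu> *s P" "f Q = \<mu> *s Q"
    using central_corner_sum[OF corners(1)[OF P_in] corners(3)[OF Q_in]] by blast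
  define g where "g = (\<lambda>z. f z - \<mu> *s z)"
  have g: "module_hom scale scale g"
    using f.add f.scale
    by (simp add: g_def module_hom_iff module_axioms scale_right_distrib
        scale_right_diff_distrib mult.commute)
  have g_corners: "x \<in> peirce P P \<Longrightarrow> g x \<in> peirce P P"
      "m \<in> peirce P Q \<Longrightarrow> g m \<in> peirce P Q"
      "y \<in> peirce Q Q \<Longrightarrow> g y \<in> peirce Q Q" for x m y
    using corners(1)[of x] corners(2)[of m] corners(3)[of y]
    by (simp_all add: corner_iff g_def scale_mult_left scale_mult_right algebra_simps)
  have "g (u * v) = g u * v + u * g v" for u v
  proof (rule derivationI[OF g g_corners])
    show "g (x * m) = g x * m + x * g m" if "x \<in> peirce P P" "m \<in> peirce P Q" for x m
      using left[OF that] that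
      by (simp add: g_def \<mu> peirce_simps scale_mult_left scale_mult_right algebra_simps)
    show "g (m * y) = g m * y + m * g y" if "m \<in> peirce P Q" "y \<in> peirce Q Q" for m y
      using right[OF that] that
      by (simp add: g_def \<mu> peirce_simps scale_mult_left scale_mult_right algebra_simps)
  qed
  then have "jordan_defect g A B = 0" for A B
    using module_hom.add[OF g] by (simp add: jordan_defect_def jordan_prod_def algebra_simps)
  then have "jordan_defect f A B = - (\<mu> *s (A \<circle> B))" for A B
    by (simp add: g_def jordan_defect_diff jordan_defect_scaling eq_neg_iff_add_eq_0)
  then show ?thesis by blast
qed

section \<open>Removing an inner derivation and excluding the scalar part\<close>

lemma jordan_derivable_up_to_scaling:
  assumes d: "module_hom scale scale d"
    and at_C: "\<And>A B. A * B = C \<Longrightarrow> jordan_defect d A B = 0"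
  shows "\<exists>\<mu>. \<forall>A B. jordan_defect d A B = - (\<mu> *s (A \<circle> B))"
proof -
  interpret d: module_hom scale scale d by (rule d)
  have J: "jordan_defect d x y = 0" "jordan_defect d (x * m) y = jordan_defect d x (m * y)"
    if "x \<in> peirce P P" "y \<in> peirce Q Q" "m \<in> peirce P Q" for x y m
    using jordan_defect_corners[OF d at_C that] by auto
  note simps = jordan_defect_def jordan_prod_def peirce_simps peirce_products peirce_zero_products
    P_in Q_in idem_P idem_Q PQ QP
  \<comment> \<open>As \<open>x \<circle> Q = 0\<close>, the sum is minus the defect at
    \<open>x\<close>, \<open>Q\<close>. The off-diagonal argument of \<open>J\<close> is filled with
    \<open>0\<close>.\<close>
  have xQ: "d x * Q + x * d Q + (d Q * x + Q * d x) = 0" if "x \<in> peirce P P" for x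
  proof -
    have "d x * Q + x * d Q + (d Q * x + Q * d x) = - jordan_defect d x Q"
      using that by (simp add: simps algebra_simps)
    then show ?thesis
      by (simp only: J(1)[OF that Q_in zero_in_peirce] minus_zero)
  qed
  have Py: "d P * y + P * d y + (d y * P + y * d P) = 0" if "y \<in> peirce Q Q" for y
  proof -
    have "d P * y + P * d y + (d y * P + y * d P) = - jordan_defect d P y"
      using that by (simp add: simps algebra_simps)
    then show ?thesis
      by (simp only: J(1)[OF P_in that zero_in_peirce] minus_zero)
  qed
  \<comment> \<open>Compressing the two relations by \<open>P\<close> and \<open>Q\<close> on either
    side reads off the Peirce components of \<open>d x\<close> and \<open>d y\<close>.\<close>
  have QdxQ: "Q * (d x * Q) = 0" if "x \<in> peirce P P" for x
    using arg_cong[OF xQ[OF that], of "\<lambda>z. Q * (z * Q)"] that double_eq_0_iff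
    by (simp add: distrib_left distrib_right mult.assoc simps)
  have PdxQ: "P * (d x * Q) = - (x * (d Q * Q))" if "x \<in> peirce P P" for x
    using arg_cong[OF xQ[OF that], of "\<lambda>z. P * (z * Q)"] that Q_mult_P
    by (simp add: distrib_left distrib_right mult.assoc simps eq_neg_iff_add_eq_0)
  have PdyP: "P * (d y * P) = 0" if "y \<in> peirce Q Q" for y
    using arg_cong[OF Py[OF that], of "\<lambda>z. P * (z * P)"] that double_eq_0_iff
    by (simp add: distrib_left distrib_right mult.assoc simps)
  have PdyQ: "P * (d y * Q) = - (P * (d P * y))" if "y \<in> peirce Q Q" for y
    using arg_cong[OF Py[OF that], of "\<lambda>z. P * (z * Q)"] that Q_mult_P
    by (simp add: distrib_left distrib_right mult.assoc simps eq_neg_iff_add_eq_0 add.commute)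
  \<comment> \<open>By \<open>PdxQ\<close> and \<open>PdyQ\<close>, the off-diagonal parts of
    \<open>d x\<close> and \<open>d y\<close> are \<open>x * k\<close> and \<open>- (k * y)\<close>,
    exactly the values of \<open>z * k - k * z\<close> at \<open>x\<close> and
    \<open>y\<close>.\<close>
  define k where "k = P * (d P * Q)"
  have k: "k \<in> peirce P Q"
    unfolding k_def peirce_def mult.assoc[symmetric] by blast
  define g where "g = (\<lambda>z. d z - (z * k - k * z))"
  have g: "module_hom scale scale g"
    using d.add d.scale
    by (simp add: g_def module_hom_iff module_axioms scale_right_diff_distrib
        scale_mult_left scale_mult_right algebra_simps)
  have J_g: "jordan_defect g A B = jordan_defect d A B" for A B
    unfolding g_def jordan_defect_diff[of d] jordan_defect_inner by simp
  have split: "d z = P * (d z * P) + P * (d z * Q) + Q * (d z * Q)" for z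
    by (rule peirce_sum)
  have "\<exists>\<mu>. \<forall>A B. jordan_defect g A B = - (\<mu> *s (A \<circle> B))"
  proof (rule jordan_defect_corner_preserving[OF g])
    fix x assume x: "x \<in> peirce P P"
    have "x * k = P * (d x * Q)"
      using PdxQ[OF x] PdxQ[OF P_in] x by (simp add: k_def peirce_simps)
    then have "g x = P * d x * P"
      using split[of x] QdxQ[OF x] x k
      by (simp add: g_def peirce_zero_products mult.assoc diff_eq_eq add.commute)
    then show "g x \<in> peirce P P"
      unfolding peirce_def by blast
  next
    fix y assume y: "y \<in> peirce Q Q"
    have "k * y = - (P * (d y * Q))"
      using PdyQ[OF y] y by (simp add: k_def mult.assoc peirce_simps)
    then have "g y = Q * d y * Q"
      using split[of y] PdyP[OF y] y k
      by (simp add: g_def peirce_zero_products mult.assoc diff_eq_eq add.commute)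
    then show "g y \<in> peirce Q Q"
      unfolding peirce_def by blast
  next
    fix m assume m: "m \<in> peirce P Q"
    have 0: "m * (z * P) = 0" "Q * (z * m) = 0" for z
      using Q_mult_P[of z] peirce_PQ_simps[OF m] Q_mult_P[of "z * P"]
      by (metis mult.assoc mult_zero_right mult_zero_left)+
    \<comment> \<open>This is the balance relation for \<open>x = P\<close>, \<open>y = Q\<close>.
      Compressed to either diagonal corner, one side vanishes and the other is twice the component
      of \<open>d m\<close>.\<close>
    have eq: "d m * Q + m * d Q + (d Q * m + Q * d m) = d P * m + P * d m + (d m * P + m * d P)"
    proof -
      have "jordan_defect d m Q = d m - (d m * Q + m * d Q + (d Q * m + Q * d m))"
        and "jordan_defect d P m = d m - (d P * m + P * d m + (d m * P + m * d P))"
        using m by (simp_all add: simps algebra_simps)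
      moreover have "jordan_defect d m Q = jordan_defect d P m"
        using J(2)[OF P_in Q_in m] m by (simp add: peirce_simps)
      ultimately show ?thesis by (metis diff_left_imp_eq)
    qed
    have "P * (d m * P) = 0"
      using arg_cong[OF eq, of "\<lambda>z. P * (z * P)"] m double_eq_0_iff
      by (simp add: distrib_left distrib_right mult.assoc simps 0)
    moreover have "Q * (d m * Q) = 0"
      using arg_cong[OF eq, of "\<lambda>z. Q * (z * Q)"] m double_eq_0_iff
      by (simp add: distrib_left distrib_right mult.assoc simps 0)
    \<comment> \<open>Products within \<open>peirce P Q\<close> vanish, so the inner derivation does
      not change \<open>d m\<close>.\<close>
    ultimately have "g m = P * d m * Q"
      using split[of m] m k by (simp add: g_def peirce_zero_products mult.assoc)
    then show "g m \<in> peirce P Q"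
      unfolding peirce_def by blast
  qed (simp add: J_g J)
  then show ?thesis by (simp only: J_g)
qed

lemma jordan_derivable_imp_jordan_derivation:
  assumes d: "module_hom scale scale d"
    and at_C: "\<And>A B. A * B = C \<Longrightarrow> jordan_defect d A B = 0"
  shows "jordan_defect d A B = 0"
proof -
  obtain \<mu> where \<mu>: "\<And>A B. jordan_defect d A B = - (\<mu> *s (A \<circle> B))"
    using jordan_derivable_up_to_scaling[OF d at_C] by blast
  show ?thesis
  proof (cases "\<mu> = 0")
    case False
    have anti: "A \<circle> B = 0" if "A * B = C" for A B
      using at_C[OF that] \<mu> False by simp
    have "C = 0"
      using anti[of 1 C] double_eq_0_iff by (simp add: jordan_prod_def)
    \<comment> \<open>Since \<open>m * P = 0 = C\<close>, the pair \<open>m\<close>,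
      \<open>P\<close> is admissible, and \<open>m \<circle> P\<close> reduces to
      \<open>P * m\<close>.\<close>
    then have "P * m = 0" if "m \<in> peirce P Q" for m
      using anti[of m P] that by (simp add: jordan_prod_def peirce_simps)
    then have "P = 0" by (rule faithful_left[OF P_in])
    then show ?thesis using P_nonzero by simp
  qed (simp add: \<mu>)
qed

end

theorem corollary3p5:
  fixes scale :: "'f::field_char_0 \<Rightarrow> 'a::ring_1 \<Rightarrow> 'a"
    and P Q C :: 'a
  assumes "unital_algebra scale"
    and "P * P = P" and "P \<noteq> 0" and "P \<noteq> 1"
    and "Q = 1 - P"
    and "peirce P P \<subseteq> module.span scale (corner_invertibles P)"
    and "peirce Q Q \<subseteq> module.span scale (corner_invertibles Q)"
    and "faithful_peirce12 P"
    and "peirce Q P = {0}"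
    and "algebra_center = range (\<lambda>c. scale c (1::'a))"
  shows "jordan_higher_all_derivable_point scale C"
proof -
  interpret unital_algebra scale by (rule assms(1))
  interpret triangular_algebra scale P Q
    by unfold_locales (use assms in auto)
  show ?thesis
    by (rule jordan_higher_all_derivable_pointI) (rule jordan_derivable_imp_jordan_derivation)
qed

end
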